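(* Let $X$ and $Y$ be transitive subshifts and let $\varphi: X\rightarrow Y$ be a hyperbolic factor map. Then $X$ is half-synchronized if and only if $Y$ is half-synchronized.
   Context: A subshift (shift space) $X$ over a finite non-empty alphabet $\mathcal A$ is a closed shift-invariant subset of $\mathcal A^{\mathbb Z}$ (with the shift map $\sigma(x)_i=x_{i+1}$). $\mathcal B_n(X)$ is the set of blocks of length $n$ occurring in points of $X$, and $\mathcal B(X)=\bigcup_{n\ge 0}\mathcal B_n(X)$ is the language of $X$; $|u|$ is the length of a block $u$, and $x_{[i,j]}=x_i x_{i+1}\cdots x_j$. $X$ is transitive (irreducible) if for all $u,v\in\mathcal B(X)$ there is a block $w$ with $uwv\in\mathcal B(X)$. A factor map $\varphi:X\to Y$ is an onto sliding block code, i.e. a surjective map for which there are integers $m,n$ with $-m\le n$ and a block map $\Phi:\mathcal B_{m+n+1}(X)\to\mathcal D$ ($\mathcal D$ the alphabet of $Y$) such that $\varphi(x)_i=\Phi(x_{[i-m,i+n]})$ for all $i\in\mathbb Z$. Follower sets: $X^+=\{(x_i)_{i\ge 0}: x\in X\}$. For a left-infinite ray $x_-$ of $X$ (the left half of a point of $X$, such as $x_{(-\infty,0]}$, up to re-indexing), $\omega_+(x_-)$ is the set of right-infinite rays $x_+\in X^+$ such that the concatenation $x_-x_+$ is a point of $X$. For a block $m\in\mathcal B(X)$, $\omega_+(m)$ is the set of right-infinite rays $x_+\in X^+$ such that $m x_+$ occurs in a point of $X$ (that is, some point of $X$ has a right ray equal to $mx_+$). A point $x\in X$ is left-transitive if every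 block of $\mathcal B(X)$ appears in $x$ infinitely often to the left. Half-synchronized: a transitive subshift $X$ is half-synchronized if there is a block $m\in\mathcal B(X)$ and a left-transitive point $x\in X$ such that $x_{[-|m|+1,0]}=m$ and $\omega_+(x_{(-\infty,0]})=\omega_+(m)$. Hyperbolic: a factor map $\varphi:X\to Y$ between transitive subshifts is hyperbolic if there are $d\in\mathbb N$, integers $n,k\ge 0$, a block $w\in\mathcal B_{2n+1}(Y)$ and $d$ blocks $m^{(1)},\dots,m^{(d)}\in\mathcal B_{2k+1}(X)$ such that: (1) if $y\in Y$ satisfies $y_{[-n,n]}=w$, then $\{x_{[-k,k]}: x\in\varphi^{-1}(y)\}=\{m^{(1)},\dots,m^{(d)}\}$; (2) if $w'\in\mathcal B(Y)$ begins and ends with $w$, of length $|w'|=2n+1+p$ with $p\ge 0$, then for each $1\le i\le d$ there is a unique block $a^i\in\mathcal B(X)$ such that for every $x\in X$ with $\varphi(x)_{[-n,n+p]}=w'$ and $x_{[-k,k]}=m^{(i)}$ one has $x_{[-k,k+p]}=a^i$. *)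

theory Defs
  imports "HOL-Analysis.Analysis" "HOL-Library.Omega_Words_Fun"
begin

definition shift :: "(int \<Rightarrow> 'a) \<Rightarrow> int \<Rightarrow> 'a" where
  "shift x = (\<lambda>i. x (i + 1))"

definition subshift :: "'a set \<Rightarrow> (int \<Rightarrow> 'a) set \<Rightarrow> bool" where
  "subshift A X \<longleftrightarrow> finite A \<and> A \<noteq> {} \<and>
     closedin (product_topology (\<lambda>_. discrete_topology A) UNIV) X \<and> shift ` X = X"

text \<open>The block of \<open>x\<close> over the positions from \<open>i\<close> to \<open>j\<close>, both included; it is empty if \<open>j < i\<close>.\<close>

definition block :: "(int \<Rightarrow> 'a) \<Rightarrow> int \<Rightarrow> int \<Rightarrow> 'a list" where
  "block x i j = map x [i..j]"

definition blocks :: "(int \<Rightarrow> 'a) set \<Rightarrow> nat \<Rightarrow> 'a list set" where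
  "blocks X n = {block x i (i + int n - 1) | x i. x \<in> X}"

definition language :: "(int \<Rightarrow> 'a) set \<Rightarrow> 'a list set" where
  "language X = (\<Union>n. blocks X n)"

definition transitive_shift :: "(int \<Rightarrow> 'a) set \<Rightarrow> bool" where
  "transitive_shift X \<longleftrightarrow> (\<forall>u\<in>language X. \<forall>v\<in>language X. \<exists>w. u @ w @ v \<in> language X)"

text \<open>The block map \<open>\<Phi>\<close> is only evaluated on blocks of \<open>X\<close> of length \<open>m + n + 1\<close>; there its
  values are symbols of \<open>Y\<close> because \<open>\<phi> ` X = Y\<close>. The values of \<open>\<phi>\<close> outside \<open>X\<close> are irrelevant.\<close>

definition factor_map ::
    "(int \<Rightarrow> 'a) set \<Rightarrow> (int \<Rightarrow> 'b) set \<Rightarrow> ((int \<Rightarrow> 'a) \<Rightarrow> (int \<Rightarrow> 'b)) \<Rightarrow> bool" where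
  "factor_map X Y \<phi> \<longleftrightarrow> \<phi> ` X = Y \<and>
     (\<exists>m n :: int. - m \<le> n \<and>
       (\<exists>\<Phi> :: 'a list \<Rightarrow> 'b. \<forall>x\<in>X. \<forall>i. \<phi> x i = \<Phi> (block x (i - m) (i + n))))"

definition right_ray :: "(int \<Rightarrow> 'a) \<Rightarrow> nat \<Rightarrow> 'a" where
  "right_ray x = (\<lambda>k. x (int k))"

definition right_rays :: "(int \<Rightarrow> 'a) set \<Rightarrow> (nat \<Rightarrow> 'a) set" where
  "right_rays X = right_ray ` X"

text \<open>Left-infinite rays are indexed from right to left: this is the ray of \<open>x\<close> over the
  positions \<open>\<le> 0\<close>, with index \<open>k\<close> standing for position \<open>- k\<close>.\<close>

definition left_ray :: "(int \<Rightarrow> 'a) \<Rightarrow> nat \<Rightarrow> 'a" where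
  "left_ray x = (\<lambda>k. x (- int k))"

text \<open>The concatenation of a left-infinite and a right-infinite ray, the latter starting at
  position 0 (the choice of origin is immaterial for shift-invariant sets).\<close>

definition join_rays :: "(nat \<Rightarrow> 'a) \<Rightarrow> (nat \<Rightarrow> 'a) \<Rightarrow> int \<Rightarrow> 'a" where
  "join_rays l r = (\<lambda>i. if i < 0 then l (nat (- i - 1)) else r (nat i))"

definition follower_ray :: "(int \<Rightarrow> 'a) set \<Rightarrow> (nat \<Rightarrow> 'a) \<Rightarrow> (nat \<Rightarrow> 'a) set" where
  "follower_ray X l = {r \<in> right_rays X. join_rays l r \<in> X}"

text \<open>Here \<open>m \<frown> r\<close> is the library's concatenation of a finite and an infinite word.\<close>

definition follower_block :: "(int \<Rightarrow> 'a) set \<Rightarrow> 'a list \<Rightarrow> (nat \<Rightarrow> 'a) set" where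
  "follower_block X m = {r \<in> right_rays X. \<exists>x\<in>X. right_ray x = m \<frown> r}"

definition left_transitive :: "(int \<Rightarrow> 'a) set \<Rightarrow> (int \<Rightarrow> 'a) \<Rightarrow> bool" where
  "left_transitive X x \<longleftrightarrow> x \<in> X \<and>
     (\<forall>u\<in>language X. infinite {i. i \<le> 0 \<and> block x i (i + int (length u) - 1) = u})"

definition half_synchronized :: "(int \<Rightarrow> 'a) set \<Rightarrow> bool" where
  "half_synchronized X \<longleftrightarrow>
     (\<exists>m\<in>language X. \<exists>x. left_transitive X x \<and>
        block x (- int (length m) + 1) 0 = m \<and>
        follower_ray X (left_ray x) = follower_block X m)"

definition hyperbolic ::
    "(int \<Rightarrow> 'a) set \<Rightarrow> (int \<Rightarrow> 'b) set \<Rightarrow> ((int \<Rightarrow> 'a) \<Rightarrow> (int \<Rightarrow> 'b)) \<Rightarrow> bool" where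
  "hyperbolic X Y \<phi> \<longleftrightarrow>
     (\<exists>(d::nat) (n::nat) (k::nat) (w :: 'b list) (m :: nat \<Rightarrow> 'a list).
        w \<in> blocks Y (2 * n + 1) \<and>
        m ` {1..d} \<subseteq> blocks X (2 * k + 1) \<and> inj_on m {1..d} \<and>
        (\<forall>y\<in>Y. block y (- int n) (int n) = w \<longrightarrow>
           {block x (- int k) (int k) | x. x \<in> X \<and> \<phi> x = y} = m ` {1..d}) \<and>
        (\<forall>w'\<in>language Y. \<forall>p.
           length w' = 2 * n + 1 + p \<and> take (2 * n + 1) w' = w \<and> drop p w' = w \<longrightarrow>
           (\<forall>i\<in>{1..d}. \<exists>!a. a \<in> language X \<and>
              (\<forall>x\<in>X. block (\<phi> x) (- int n) (int n + int p) = w' \<and>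
                 block x (- int k) (int k) = m i \<longrightarrow>
                 block x (- int k) (int k + int p) = a))))"

end

theory Submission
  imports Defs
begin

text \<open>Half-synchronization of \<open>X\<close> says that some left-transitive point \<open>x\<close> has a window such that any
point of \<open>X\<close> that agrees with \<open>x\<close> on the window may have everything to the left of it replaced
by the past of \<open>x\<close>. In this form (\<open>half_synchronized_iff\<close>) the property can be
carried through a hyperbolic map, because the positions at which the word \<open>w\<close> occurs in a point
\<open>y\<close> of \<open>Y\<close> control its preimages. At each such position the preimages show the same \<open>d\<close>
blocks, here called labels. Between two marked positions, the label at the left one determines
the preimage, and this sends labels at the left onto labels at the right; as there are \<open>d\<close> of them
on either side, it is a bijection, so the label at the right determines the preimage as well.

From \<open>X\<close> to \<open>Y\<close> (\<open>half_synchronized_image\<close>): the future of \<open>x\<close> may be changed so that \<open>\<phi> x\<close> is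
marked on both sides of the synchronizing window. A point \<open>y'\<close> that agrees with \<open>\<phi> x\<close> between these
marks lifts to a point that agrees with \<open>x\<close> on the window. The past of \<open>x\<close> can be attached to the
lift, and the image of the result is \<open>y'\<close> with the past of \<open>\<phi> x\<close>.

From \<open>Y\<close> to \<open>X\<close> (\<open>half_synchronized_lift\<close>): let \<open>x\<close> lie over the synchronizing point \<open>y\<close>. It is
left-transitive (\<open>left_transitive_lift\<close>), because \<open>y\<close> contains a word that forces a given block of
\<open>X\<close> to appear in its preimages, whatever their label. If \<open>z\<close> agrees with \<open>x\<close> on a
long window, then the past of \<open>y\<close> can be attached to \<open>\<phi> z\<close>, and a lift of the result with the label
of \<open>x\<close> has the past of \<open>x\<close> because \<open>y\<close> is marked arbitrarily far to the left. To the right the lift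
need not follow \<open>z\<close>, as \<open>\<phi> z\<close> may have no marks there. So \<open>z\<close> is first replaced, beyond
a distant coordinate \<open>M\<close>, by a continuation whose image has a mark; the lift then follows \<open>z\<close> up to
\<open>M\<close>, and compactness lets \<open>M\<close> tend to infinity.\<close>

section \<open>Points, windows and translates\<close>

definition translate :: "int \<Rightarrow> (int \<Rightarrow> 'a) \<Rightarrow> int \<Rightarrow> 'a" where
  "translate s x = (\<lambda>i. x (i + s))"

definition splice_at :: "int \<Rightarrow> (int \<Rightarrow> 'a) \<Rightarrow> (int \<Rightarrow> 'a) \<Rightarrow> int \<Rightarrow> 'a" where
  "splice_at c x z = (\<lambda>i. if i \<le> c then x i else z i)"

lemma translate_apply [simp]: "translate s x i = x (i + s)"
  by (simp add: translate_def)

lemma translate_translate [simp]: "translate s (translate t x) = translate (s + t) x"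
  by (auto simp: fun_eq_iff add_ac)

lemma translate_0 [simp]: "translate 0 x = x"
  by (auto simp: fun_eq_iff)

lemma block_eq_iff: "block x a b = block z a b \<longleftrightarrow> (\<forall>i\<in>{a..b}. x i = z i)"
  by (auto simp: block_def)

lemma length_block: "length (block x a b) = nat (b - a + 1)"
  by (simp add: block_def)

lemma nth_block: "j < nat (b - a + 1) \<Longrightarrow> block x a b ! j = x (a + int j)"
  by (simp add: block_def)

lemma block_translate: "block (translate s x) a b = block x (a + s) (b + s)"
  by (rule nth_equalityI) (auto simp: length_block nth_block add_ac)

lemma translate_shift_closed:
  assumes "shift ` X = X" "x \<in> X"
  shows "translate s x \<in> X"
proof -
  have up: "translate (int j) v \<in> X" if "v \<in> X" for v j
  proof (induction j)
    case (Suc j)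
    then have "shift (translate (int j) v) \<in> X" using assms(1) by blast
    moreover have "shift (translate (int j) v) = translate (int (Suc j)) v"
      by (auto simp: shift_def fun_eq_iff add_ac)
    ultimately show ?case by (simp only:)
  qed (use that in simp)
  have down: "\<exists>v\<in>X. translate (int j) v = x" for j
  proof (induction j)
    case (Suc j)
    then obtain v where v: "v \<in> X" "translate (int j) v = x" by blast
    then obtain v' where v': "v' \<in> X" "v = shift v'" using assms(1) by blast
    have "translate (int (Suc j)) v' = translate (int j) v"
      by (auto simp: shift_def fun_eq_iff add_ac v'(2))
    with v v' show ?case by (intro bexI[of _ v']) (simp_all only:)
  qed (use assms in auto)
  show ?thesis
  proof (cases "s \<ge> 0")
    case True
    then show ?thesis using up[OF assms(2), of "nat s"] by simp
  next
    case False
    obtain v where v: "v \<in> X" "translate (int (nat (- s))) v = x" using down by blast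
    have "translate s x = translate (s + int (nat (- s))) v"
      unfolding v(2)[symmetric] by (rule translate_translate)
    with False v(1) show ?thesis by simp
  qed
qed

lemma block_in_language:
  assumes "x \<in> X"
  shows "block x a b \<in> language X"
proof (cases "a \<le> b + 1")
  case True
  then show ?thesis using assms unfolding language_def blocks_def
    by (auto intro!: exI[of _ "nat (b - a + 1)"] exI[of _ x] exI[of _ a])
next
  case False
  then have "block x a b = block x a (a + int 0 - 1)" by (simp add: block_def)
  then show ?thesis using assms unfolding language_def blocks_def by blast
qed

lemma language_cases:
  assumes "shift ` X = X" "u \<in> language X"
  obtains x where "x \<in> X" "block x a (a + int (length u) - 1) = u"
proof -
  from assms(2) obtain x i l where x: "x \<in> X" "u = block x i (i + int l - 1)"
    by (auto simp: language_def blocks_def)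
  have "length u = l" by (simp add: x(2) length_block)
  with x show ?thesis
    by (intro that[of "translate (i - a) x"])
       (auto simp: block_translate translate_shift_closed[OF assms(1)] algebra_simps)
qed

text \<open>Transitivity in terms of points, so that later arguments never handle blocks as lists: the
window \<open>c..d\<close> of \<open>v\<close> is placed somewhere to the right of the window \<open>a..b\<close> of \<open>x\<close>.\<close>
lemma transitive_shift_glue:
  assumes "shift ` X = X" "transitive_shift X" "x \<in> X" "v \<in> X" "a \<le> b" "c \<le> d"
  obtains z s where "z \<in> X" "\<And>i. i \<in> {a..b} \<Longrightarrow> z i = x i"
    "\<And>i. i \<in> {c..d} \<Longrightarrow> z (i + s) = v i" "b < c + s"
proof -
  let ?u = "block x a b" and ?v = "block v c d"
  from assms(2-4) block_in_language obtain g where g: "?u @ g @ ?v \<in> language X"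
    unfolding transitive_shift_def by blast
  obtain z where z: "z \<in> X"
      "block z a (a + int (length (?u @ g @ ?v)) - 1) = ?u @ g @ ?v"
    using language_cases[OF assms(1) g] by blast
  define l where "l = int (length g)"
  have e: "a + int (length (?u @ g @ ?v)) - 1 = b + 1 + l + (d - c)"
    using assms(5,6) by (simp add: length_block l_def)
  have n: "z (a + int j) = (?u @ g @ ?v) ! j" if "j < nat (b + 1 + l + (d - c) - a + 1)" for j
    using nth_block[OF that, of z] z(2) unfolding e by (simp only:)
  show ?thesis
  proof (rule that[OF z(1)])
    fix i assume i: "i \<in> {a..b}"
    then show "z i = x i" using n[of "nat (i - a)"] assms(5,6)
      by (simp add: nth_append length_block nth_block l_def)
  next
    fix i assume i: "i \<in> {c..d}"
    have "z (i + (b + 1 + l - c)) = (?u @ g @ ?v) ! nat (i + (b + 1 + l - c) - a)"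
      using n[of "nat (i + (b + 1 + l - c) - a)"] i assms(5) by (simp add: l_def)
    also have "nat (i + (b + 1 + l - c) - a) = length ?u + (length g + nat (i - c))"
      using i assms(5) by (auto simp: length_block l_def)
    also have "(?u @ g @ ?v) ! \<dots> = v i"
      using i by (simp only: nth_append_length_plus) (simp add: nth_block)
    finally show "z (i + (b + 1 + l - c)) = v i" .
  qed (simp add: l_def)
qed

text \<open>The windows \<open>- M..M\<close> give a neighbourhood basis in the product topology because a basic open set
restricts only finitely many coordinates.\<close>
lemma subshift_limit:
  assumes "subshift A X" "\<And>M. \<exists>z\<in>X. \<forall>i\<in>{- M..M}. z i = x i"
  shows "x \<in> X"
proof (rule ccontr)
  assume "x \<notin> X"
  let ?T = "product_topology (\<lambda>_::int. discrete_topology A) UNIV"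
  have cl: "closedin ?T X" using assms(1) by (simp add: subshift_def)
  then have sub: "X \<subseteq> (\<Pi>\<^sub>E i\<in>UNIV. A)" using closedin_subset by fastforce
  have "x i \<in> A" for i
  proof -
    obtain z where "z \<in> X" "\<forall>j\<in>{- \<bar>i\<bar>..\<bar>i\<bar>}. z j = x j" using assms(2) by blast
    moreover have "i \<in> {- \<bar>i\<bar>..\<bar>i\<bar>}" by auto
    ultimately show ?thesis using sub by (metis PiE_mem UNIV_I subsetD)
  qed
  then have "x \<in> topspace ?T - X" using \<open>x \<notin> X\<close> by auto
  moreover have "openin ?T (topspace ?T - X)" using cl by blast
  ultimately have "\<exists>U. finite {i. U i \<noteq> A} \<and> x \<in> Pi\<^sub>E UNIV U \<and> Pi\<^sub>E UNIV U \<subseteq> topspace ?T - X"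
    unfolding openin_product_topology_alt by simp blast
  then obtain U where U: "finite {i. U i \<noteq> A}" "x \<in> Pi\<^sub>E UNIV U"
      "Pi\<^sub>E UNIV U \<subseteq> topspace ?T - X"
    by blast
  from U(1) obtain M where M: "\<forall>i\<in>{i. U i \<noteq> A}. \<bar>i\<bar> \<le> M"
    by (metis bdd_above_finite bdd_above.unfold finite_imageI image_eqI)
  obtain z where z: "z \<in> X" "\<forall>i\<in>{- M..M}. z i = x i" using assms(2) by blast
  have "z i \<in> U i" for i
  proof (cases "U i = A")
    case True
    then show ?thesis using z(1) sub by auto
  next
    case False
    then have "i \<in> {- M..M}" using M by fastforce
    then show ?thesis using z(2) U(2) by auto
  qed
  then have "z \<in> Pi\<^sub>E UNIV U" by auto
  then show False using U(3) z(1) by blast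
qed

section \<open>Left-transitivity and half-synchronization in terms of points\<close>

text \<open>A set of nonpositive integers is infinite iff it is unbounded below, and requiring occurrences
beyond every bound \<open>N\<close> makes the notion manifestly dependent on the far past only.\<close>
lemma left_transitive_iff:
  assumes "shift ` X = X"
  shows "left_transitive X x \<longleftrightarrow>
    x \<in> X \<and> (\<forall>v\<in>X. \<forall>a b N. \<exists>s. b + s \<le> N \<and> (\<forall>i\<in>{a..b}. x (i + s) = v i))"
    (is "_ \<longleftrightarrow> _ \<and> ?R")
proof safe
  assume lt: "left_transitive X x"
  then show "x \<in> X" by (simp add: left_transitive_def)
  fix v a b N assume v: "v \<in> X"
  let ?l = "int (length (block v a b))"
  have inf: "infinite {i. i \<le> 0 \<and> block x i (i + ?l - 1) = block v a b}"
    using lt block_in_language[OF v] by (simp add: left_transitive_def)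
  have "\<exists>i. i \<le> 0 \<and> block x i (i + ?l - 1) = block v a b \<and> b + (i - a) \<le> N"
  proof (rule ccontr)
    assume "\<not> ?thesis"
    then have "{i. i \<le> 0 \<and> block x i (i + ?l - 1) = block v a b} \<subseteq> {N + a - b..0}"
      by force
    then show False using inf finite_subset by blast
  qed
  then obtain i where i: "block x i (i + ?l - 1) = block v a b" "b + (i - a) \<le> N" by blast
  have "x (j + (i - a)) = v j" if "j \<in> {a..b}" for j
  proof -
    have "block x i (i + ?l - 1) ! nat (j - a) = x (i + int (nat (j - a)))"
      using that by (intro nth_block) (simp add: length_block)
    moreover have "block v a b ! nat (j - a) = v (a + int (nat (j - a)))"
      using that by (intro nth_block) simp
    ultimately show ?thesis using i(1) that by (simp add: algebra_simps)
  qed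
  with i(2) show "\<exists>s. b + s \<le> N \<and> (\<forall>i\<in>{a..b}. x (i + s) = v i)" by blast
next
  assume x: "x \<in> X" and R: ?R
  have "infinite {i. i \<le> 0 \<and> block x i (i + int (length u) - 1) = u}" (is "infinite ?S")
    if u: "u \<in> language X" for u
  proof
    assume fin: "finite ?S"
    obtain v where v: "v \<in> X" "block v 0 (0 + int (length u) - 1) = u"
      using language_cases[OF assms u] by blast
    obtain L where L: "\<forall>i\<in>?S. L \<le> i" using fin by (metis bdd_below_finite bdd_below.unfold)
    obtain s where s: "int (length u) + s \<le> min 0 (L - 1)"
        "\<forall>i\<in>{0..int (length u)}. x (i + s) = v i"
      using R v(1) by blast
    have "block x s (s + int (length u) - 1) = block (translate s x) 0 (int (length u) - 1)"
      by (simp add: block_translate algebra_simps)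
    also have "\<dots> = block v 0 (int (length u) - 1)" using s(2) by (simp add: block_eq_iff)
    finally have "s \<in> ?S" using s(1) v(2) by simp
    then have "L \<le> s" using L by blast
    with s(1) show False by linarith
  qed
  with x show "left_transitive X x" by (simp add: left_transitive_def)
qed

lemma left_transitive_obtain:
  assumes "shift ` X = X" "left_transitive X x" "v \<in> X"
  obtains s where "b + s \<le> N" "\<And>i. i \<in> {a..b} \<Longrightarrow> x (i + s) = v i"
  using assms left_transitive_iff by metis

lemma left_transitive_if_same_left_ray:
  assumes "shift ` X = X" "left_transitive X x" "z \<in> X" "\<And>i. i \<le> c \<Longrightarrow> z i = x i"
  shows "left_transitive X z"
  unfolding left_transitive_iff[OF assms(1)]
proof (intro conjI ballI allI)
  fix v a b N assume "v \<in> X"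
  then obtain s where "b + s \<le> min N c" "\<And>i. i \<in> {a..b} \<Longrightarrow> x (i + s) = v i"
    using left_transitive_obtain[OF assms(1,2)] by metis
  then show "\<exists>s. b + s \<le> N \<and> (\<forall>i\<in>{a..b}. z (i + s) = v i)"
    using assms(4) by (intro exI[of _ s]) auto
qed fact

lemma left_transitive_translate:
  assumes "shift ` X = X" "left_transitive X x"
  shows "left_transitive X (translate t x)"
  unfolding left_transitive_iff[OF assms(1)]
proof (intro conjI ballI allI)
  show "translate t x \<in> X"
    using assms by (auto simp: left_transitive_def intro: translate_shift_closed)
  fix v a b N assume "v \<in> X"
  then obtain s where "b + s \<le> N + t" "\<And>i. i \<in> {a..b} \<Longrightarrow> x (i + s) = v i"
    using left_transitive_obtain[OF assms] by metis
  then show "\<exists>s. b + s \<le> N \<and> (\<forall>i\<in>{a..b}. translate t x (i + s) = v i)"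
    by (intro exI[of _ "s - t"]) auto
qed

text \<open>For \<open>c = 0\<close> this is the equation between the follower sets of the left ray of \<open>x\<close> and of the block
of \<open>x\<close> over \<open>a..0\<close>, see \<open>synchronizes_iff_follower\<close>. The free right end \<open>c\<close> avoids moving the
origin.\<close>
definition synchronizes :: "(int \<Rightarrow> 'a) set \<Rightarrow> (int \<Rightarrow> 'a) \<Rightarrow> int \<Rightarrow> int \<Rightarrow> bool" where
  "synchronizes X x a c \<longleftrightarrow>
     (\<forall>z\<in>X. (\<forall>i\<in>{a..c}. z i = x i) \<longrightarrow> splice_at c x z \<in> X)"

lemma follower_block_iff:
  assumes "shift ` X = X" and "a \<le> c + 1"
  shows "r \<in> follower_block X (block x a c) \<longleftrightarrow>
    (\<exists>z\<in>X. (\<forall>i\<in>{a..c}. z i = x i) \<and> (\<forall>j. r j = z (c + 1 + int j)))"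
proof -
  let ?l = "nat (c - a + 1)"
  have conc: "right_ray v = block x a c \<frown> r \<longleftrightarrow>
     (\<forall>i\<in>{a..c}. translate (- a) v i = x i) \<and> (\<forall>j. r j = translate (- a) v (c + 1 + int j))"
     (is "?L \<longleftrightarrow> ?R1 \<and> ?R2") for v
  proof safe
    assume L: ?L
    {
      fix i assume "i \<in> {a..c}"
      then show "translate (- a) v i = x i" using fun_cong[OF L, of "nat (i - a)"]
        by (simp add: conc_def right_ray_def length_block nth_block)
    }
    show "r j = translate (- a) v (c + 1 + int j)" for j
      using fun_cong[OF L, of "?l + j"] assms(2)
      by (simp add: conc_def right_ray_def length_block algebra_simps)
  next
    assume R1: ?R1 and R2: ?R2
    show ?L
    proof
      fix j
      show "right_ray v j = (block x a c \<frown> r) j"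
        using bspec[OF R1, of "a + int j"] R2[rule_format, of "j - ?l"] assms(2)
        by (simp add: conc_def right_ray_def length_block nth_block algebra_simps nat_less_iff)
    qed
  qed
  show ?thesis
  proof
    assume "r \<in> follower_block X (block x a c)"
    then obtain v where "v \<in> X" "right_ray v = block x a c \<frown> r"
      by (auto simp: follower_block_def)
    then show "\<exists>z\<in>X. (\<forall>i\<in>{a..c}. z i = x i) \<and> (\<forall>j. r j = z (c + 1 + int j))"
      unfolding conc using translate_shift_closed[OF assms(1)] by blast
  next
    assume "\<exists>z\<in>X. (\<forall>i\<in>{a..c}. z i = x i) \<and> (\<forall>j. r j = z (c + 1 + int j))"
    then obtain z where z: "z \<in> X" "\<forall>i\<in>{a..c}. z i = x i" "\<forall>j. r j = z (c + 1 + int j)"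
      by blast
    have "right_ray (translate a z) = block x a c \<frown> r"
      unfolding conc using z by simp
    moreover have "r = right_ray (translate (c + 1) z)"
      using z(3) by (auto simp: right_ray_def add_ac)
    ultimately show "r \<in> follower_block X (block x a c)"
      using translate_shift_closed[OF assms(1) z(1)] by (auto simp: follower_block_def right_rays_def)
  qed
qed

text \<open>The follower set of a left ray is always contained in that of each of its suffixes, so only the
other inclusion has content, and that is the possibility of exchanging pasts. The bound \<open>a \<le> 1\<close>
includes the empty block.\<close>
lemma synchronizes_iff_follower:
  assumes "shift ` X = X" "a \<le> 1" "x \<in> X"
  shows "synchronizes X x a 0 \<longleftrightarrow> follower_ray X (left_ray x) = follower_block X (block x a 0)"
proof -
  have join: "join_rays (left_ray x) r = translate 1 (splice_at 0 x z)"
    if "\<forall>j. r j = z (1 + int j)" for r z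
    using that by (auto simp: join_rays_def left_ray_def splice_at_def fun_eq_iff add_ac)
  have shifted: "translate 1 v \<in> X \<longleftrightarrow> v \<in> X" for v
    using translate_shift_closed[OF assms(1), of v 1]
      translate_shift_closed[OF assms(1), of "translate 1 v" "- 1"] by auto
  have sub: "follower_ray X (left_ray x) \<subseteq> follower_block X (block x a 0)"
  proof
    fix r assume r: "r \<in> follower_ray X (left_ray x)"
    let ?z = "translate (- 1) (join_rays (left_ray x) r)"
    have "?z \<in> X" using r translate_shift_closed[OF assms(1)] by (auto simp: follower_ray_def)
    moreover have "\<forall>i\<in>{a..0}. ?z i = x i" by (auto simp: join_rays_def left_ray_def)
    moreover have "\<forall>j. r j = ?z (0 + 1 + int j)" by (auto simp: join_rays_def)
    ultimately have "\<exists>z\<in>X. (\<forall>i\<in>{a..0}. z i = x i) \<and> (\<forall>j. r j = z (0 + 1 + int j))"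
      by (intro bexI[of _ ?z] conjI)
    then show "r \<in> follower_block X (block x a 0)"
      using assms(2) by (subst follower_block_iff[OF assms(1)]) simp_all
  qed
  show ?thesis
  proof
    assume s: "synchronizes X x a 0"
    have "r \<in> follower_ray X (left_ray x)" if r: "r \<in> follower_block X (block x a 0)" for r
    proof -
      obtain z where z: "z \<in> X" "\<forall>i\<in>{a..0}. z i = x i" "\<forall>j. r j = z (0 + 1 + int j)"
        using r assms(2) by (auto simp: follower_block_iff[OF assms(1)])
      then have "splice_at 0 x z \<in> X" using s by (auto simp: synchronizes_def)
      then have "join_rays (left_ray x) r \<in> X" using z(3) by (subst join[of r z]) (auto simp: shifted)
      then show ?thesis using r by (auto simp: follower_ray_def follower_block_def)
    qed
    with sub show "follower_ray X (left_ray x) = follower_block X (block x a 0)" by blast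
  next
    assume eq: "follower_ray X (left_ray x) = follower_block X (block x a 0)"
    show "synchronizes X x a 0" unfolding synchronizes_def
    proof (intro ballI impI)
      fix z assume z: "z \<in> X" "\<forall>i\<in>{a..0}. z i = x i"
      define r where "r = (\<lambda>j. z (1 + int j))"
      have "r \<in> follower_ray X (left_ray x)" unfolding eq
        using assms(2) z by (subst follower_block_iff[OF assms(1)]) (auto simp: r_def)
      then show "splice_at 0 x z \<in> X"
        using join[of r z] shifted by (auto simp: follower_ray_def r_def)
    qed
  qed
qed

lemma synchronizes_mono: "synchronizes X x a c \<Longrightarrow> a' \<le> a \<Longrightarrow> synchronizes X x a' c"
  by (auto simp: synchronizes_def)

lemma synchronizes_translate:
  assumes "shift ` X = X" "synchronizes X x a c"
  shows "synchronizes X (translate t x) (a - t) (c - t)"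
  unfolding synchronizes_def
proof (intro ballI impI)
  fix z assume z: "z \<in> X" "\<forall>i\<in>{a - t..c - t}. z i = translate t x i"
  have "\<forall>i\<in>{a..c}. translate (- t) z i = x i"
    using z(2)[rule_format, of "_ - t"] by auto
  then have "splice_at c x (translate (- t) z) \<in> X"
    using assms(2) translate_shift_closed[OF assms(1) z(1), of "- t"]
    unfolding synchronizes_def by blast
  then have "translate t (splice_at c x (translate (- t) z)) \<in> X"
    by (rule translate_shift_closed[OF assms(1)])
  also have "translate t (splice_at c x (translate (- t) z)) = splice_at (c - t) (translate t x) z"
    by (auto simp: splice_at_def fun_eq_iff)
  finally show "splice_at (c - t) (translate t x) z \<in> X" .
qed

lemma half_synchronized_iff:
  assumes "shift ` X = X"
  shows "half_synchronized X \<longleftrightarrow> (\<exists>x a c. left_transitive X x \<and> synchronizes X x a c)"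
proof
  assume "half_synchronized X"
  then obtain m x where "left_transitive X x" "block x (- int (length m) + 1) 0 = m"
      "follower_ray X (left_ray x) = follower_block X m"
    by (auto simp: half_synchronized_def)
  then have "left_transitive X x \<and> synchronizes X x (- int (length m) + 1) 0"
    by (subst synchronizes_iff_follower[OF assms]) (auto simp: left_transitive_def)
  then show "\<exists>x a c. left_transitive X x \<and> synchronizes X x a c" by blast
next
  assume "\<exists>x a c. left_transitive X x \<and> synchronizes X x a c"
  then obtain x a c where x: "left_transitive X x" "synchronizes X x a c" by blast
  define x' a' where "x' = translate c x" and "a' = min (a - c) 1"
  have lt: "left_transitive X x'" unfolding x'_def by (rule left_transitive_translate[OF assms x(1)])
  then have X: "x' \<in> X" by (simp add: left_transitive_def)
  have "synchronizes X x' (a - c) 0"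
    using synchronizes_translate[OF assms x(2), of c] by (simp add: x'_def)
  then have s: "synchronizes X x' a' 0" by (rule synchronizes_mono) (simp add: a'_def)
  let ?m = "block x' a' 0"
  have "- int (length ?m) + 1 = a'" by (simp add: length_block a'_def)
  moreover have "follower_ray X (left_ray x') = follower_block X ?m"
    using s X by (subst synchronizes_iff_follower[OF assms, symmetric]) (auto simp: a'_def)
  ultimately show "half_synchronized X"
    using lt block_in_language[OF X] unfolding half_synchronized_def by metis
qed

section \<open>Hyperbolic codes\<close>

text \<open>The counting step behind \<open>determined_left\<close>: if \<open>\<alpha>\<close> and \<open>\<beta>\<close> have the same finite image and \<open>\<alpha>\<close>
determines \<open>\<beta>\<close>, then the induced map is a surjection of a finite set onto itself, so \<open>\<beta>\<close>
determines \<open>\<alpha>\<close>.\<close>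
lemma label_of_label_injective:
  assumes "finite S" "\<alpha> ` P = S" "\<beta> ` P = S"
    and det: "\<And>x z. x \<in> P \<Longrightarrow> z \<in> P \<Longrightarrow> \<alpha> x = \<alpha> z \<Longrightarrow> \<beta> x = \<beta> z"
    and "x \<in> P" "z \<in> P" "\<beta> x = \<beta> z"
  shows "\<alpha> x = \<alpha> z"
proof -
  define g where "g s = \<beta> (SOME x. x \<in> P \<and> \<alpha> x = s)" for s
  have g: "g (\<alpha> v) = \<beta> v" if "v \<in> P" for v
  proof -
    have "(SOME u. u \<in> P \<and> \<alpha> u = \<alpha> v) \<in> P \<and> \<alpha> (SOME u. u \<in> P \<and> \<alpha> u = \<alpha> v) = \<alpha> v"
      using that by (intro someI[of "\<lambda>u. u \<in> P \<and> \<alpha> u = \<alpha> v" v]) simp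
    then show ?thesis unfolding g_def using det that by blast
  qed
  have "g ` S = S"
  proof -
    have "g ` S = (\<lambda>v. g (\<alpha> v)) ` P" using assms(2) by (simp add: image_image[symmetric])
    also have "\<dots> = \<beta> ` P" using g by (intro image_cong) auto
    finally show ?thesis using assms(3) by simp
  qed
  then have "inj_on g S" using assms(1) by (intro finite_surj_inj) auto
  moreover have "g (\<alpha> x) = g (\<alpha> z)" using g assms(5-7) by simp
  ultimately show ?thesis using assms(2,5,6) by (metis image_eqI inj_onD)
qed

text \<open>A hyperbolic factor map in terms of points. The memory and the anticipation are merged into one
radius \<open>R\<close>, the \<open>d\<close> labels become the finite set \<open>S\<close>, and uniqueness of the
block \<open>a\<^sup>i\<close> becomes the statement that two points over the same word with the same label agree.\<close>
locale hyperbolic_code =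
  fixes A :: "'a set" and X :: "(int \<Rightarrow> 'a) set" and Y :: "(int \<Rightarrow> 'b) set"
    and \<phi> :: "(int \<Rightarrow> 'a) \<Rightarrow> int \<Rightarrow> 'b"
    and R n k :: int and w :: "'b list" and S :: "'a list set"
  assumes subshift_X: "subshift A X" and transitive_X: "transitive_shift X"
    and shift_Y: "shift ` Y = Y"
    and onto: "\<phi> ` X = Y"
    and nonneg: "0 \<le> R" "0 \<le> n" "0 \<le> k"
    and local: "\<And>x z i j. \<lbrakk>x \<in> X; z \<in> X; \<forall>h\<in>{- R..R}. x (i + h) = z (j + h)\<rbrakk> \<Longrightarrow> \<phi> x i = \<phi> z j"
    and w_occurs: "\<exists>y\<in>Y. block y (- n) n = w"
    and fin: "finite S"
    and labels: "\<And>y. y \<in> Y \<Longrightarrow> block y (- n) n = w \<Longrightarrow>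
        (\<lambda>x. block x (- k) k) ` {x\<in>X. \<phi> x = y} = S"
    and determined: "\<And>x z p. \<lbrakk>x \<in> X; z \<in> X; 0 \<le> p; block (\<phi> x) (- n) n = w;
        block (\<phi> x) (p - n) (p + n) = w; block (\<phi> x) (- n) (p + n) = block (\<phi> z) (- n) (p + n);
        block x (- k) k = block z (- k) k\<rbrakk> \<Longrightarrow> block x (- k) (p + k) = block z (- k) (p + k)"
begin

definition marked :: "(int \<Rightarrow> 'b) \<Rightarrow> int \<Rightarrow> bool" where
  "marked y j \<longleftrightarrow> block y (j - n) (j + n) = w"

lemma shift_X: "shift ` X = X"
  using subshift_X by (simp add: subshift_def)

lemmas translate_X = translate_shift_closed[OF shift_X]
lemmas translate_Y = translate_shift_closed[OF shift_Y]

lemma \<phi>_in [intro]: "x \<in> X \<Longrightarrow> \<phi> x \<in> Y"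
  using onto by blast

lemma \<phi>_translate: "x \<in> X \<Longrightarrow> \<phi> (translate s x) = translate s (\<phi> x)"
  by (rule ext) (auto intro!: local translate_X simp: add_ac)

lemma \<phi>_eq: "x \<in> X \<Longrightarrow> z \<in> X \<Longrightarrow> (\<And>h. h \<in> {i - R..i + R} \<Longrightarrow> x h = z h) \<Longrightarrow> \<phi> x i = \<phi> z i"
  by (rule local) auto

lemma marked_cong:
  assumes "marked y j" "\<And>i. i \<in> {- n..n} \<Longrightarrow> y' (i + j') = y (i + j)"
  shows "marked y' j'"
proof -
  have "block (translate j' y') (- n) n = block (translate j y) (- n) n"
    using assms(2) by (simp add: block_eq_iff)
  with assms(1) show ?thesis by (simp add: marked_def block_translate algebra_simps)
qed

lemma marked_point:
  obtains x where "x \<in> X" "marked (\<phi> x) 0"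
  using w_occurs onto by (auto simp: marked_def)

lemma labels_at:
  assumes "y \<in> Y" "marked y j"
  shows "(\<lambda>x. block x (j - k) (j + k)) ` {x\<in>X. \<phi> x = y} = S"
proof -
  have tr: "{x\<in>X. \<phi> x = translate j y} = translate j ` {x\<in>X. \<phi> x = y}" (is "?L = ?M")
  proof
    show "?L \<subseteq> ?M"
    proof
      fix x assume x: "x \<in> ?L"
      then have "translate (- j) x \<in> {x\<in>X. \<phi> x = y}" by (auto simp: \<phi>_translate translate_X)
      then have "translate j (translate (- j) x) \<in> ?M" by blast
      then show "x \<in> ?M" by simp
    qed
  qed (auto simp: \<phi>_translate translate_X)
  have "block (translate j y) (- n) n = w"
    using assms(2) by (simp add: marked_def block_translate algebra_simps)
  from labels[OF translate_Y[OF assms(1)] this] show ?thesis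
    unfolding tr image_image by (simp add: block_translate algebra_simps)
qed

text \<open>Every point over \<open>y\<close> may be exchanged for a point with a prescribed label at a marked position;
the label is prescribed by a point \<open>x\<close>, whose image is marked at the same position.\<close>
lemma label_lift:
  assumes "x \<in> X" "y \<in> Y" "marked y j" "marked (\<phi> x) j"
  obtains z where "z \<in> X" "\<phi> z = y" "\<And>i. i \<in> {j - k..j + k} \<Longrightarrow> z i = x i"
proof -
  have "block x (j - k) (j + k) \<in> S"
    using labels_at[of "\<phi> x" j] assms(1,4) by blast
  then obtain z where "z \<in> X" "\<phi> z = y" "block x (j - k) (j + k) = block z (j - k) (j + k)"
    using labels_at[OF assms(2,3)] by blast
  then show ?thesis using that by (metis block_eq_iff)
qed

lemma determined_right:
  assumes "x \<in> X" "z \<in> X" "a \<le> b" "marked (\<phi> x) a" "marked (\<phi> x) b"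
    and y: "\<And>i. i \<in> {a - n..b + n} \<Longrightarrow> \<phi> x i = \<phi> z i"
    and l: "\<And>i. i \<in> {a - k..a + k} \<Longrightarrow> x i = z i"
    and i: "i \<in> {a - k..b + k}"
  shows "x i = z i"
proof -
  have "block (translate a x) (- k) (b - a + k) = block (translate a z) (- k) (b - a + k)"
  proof (rule determined)
    show "block (\<phi> (translate a x)) (- n) (b - a + n) = block (\<phi> (translate a z)) (- n) (b - a + n)"
      using y assms(1,2) by (auto simp: \<phi>_translate block_eq_iff)
    show "block (translate a x) (- k) k = block (translate a z) (- k) k"
      using l by (auto simp: block_eq_iff)
  qed (use assms in \<open>auto simp: translate_X \<phi>_translate block_translate marked_def algebra_simps\<close>)
  then have "\<forall>i\<in>{- k..b - a + k}. x (i + a) = z (i + a)" by (simp add: block_eq_iff)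
  from bspec[OF this, of "i - a"] i show ?thesis by simp
qed

text \<open>The label at the right mark determines the label at the left mark because the passage between
them permutes the labels. That argument needs points with the same image everywhere, while here
the images agree only around \<open>a..b\<close>; so \<open>z\<close> is first replaced by a point \<open>v\<close> over
\<open>\<phi> x\<close> with the label of \<open>z\<close> at \<open>a\<close>, which agrees with \<open>z\<close> between the marks.\<close>
lemma determined_left:
  assumes "x \<in> X" "z \<in> X" "a \<le> b" "marked (\<phi> x) a" "marked (\<phi> x) b"
    and y: "\<And>i. i \<in> {a - n..b + n} \<Longrightarrow> \<phi> x i = \<phi> z i"
    and l: "\<And>i. i \<in> {b - k..b + k} \<Longrightarrow> x i = z i"
    and i: "i \<in> {a - k..b + k}"
  shows "x i = z i"
proof -
  have z_marked: "marked (\<phi> z) a" "marked (\<phi> z) b"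
    using y[symmetric] assms(3) nonneg
    by (auto intro: marked_cong[OF assms(4)] marked_cong[OF assms(5)])
  obtain v where v: "v \<in> X" "\<phi> v = \<phi> x" "\<And>i. i \<in> {a - k..a + k} \<Longrightarrow> v i = z i"
    using label_lift[OF assms(2) \<phi>_in[OF assms(1)] assms(4) z_marked(1)] by blast
  have vz: "v i = z i" if "i \<in> {a - k..b + k}" for i
    by (rule determined_right[of v z a b]) (use v assms that in auto)
  let ?\<alpha> = "\<lambda>x. block x (a - k) (a + k)" and ?\<beta> = "\<lambda>x. block x (b - k) (b + k)"
  have "?\<alpha> x = ?\<alpha> v"
  proof (rule label_of_label_injective[of S ?\<alpha> "{v\<in>X. \<phi> v = \<phi> x}" ?\<beta>])
    fix u u' assume u: "u \<in> {v\<in>X. \<phi> v = \<phi> x}" "u' \<in> {v\<in>X. \<phi> v = \<phi> x}" "?\<alpha> u = ?\<alpha> u'"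
    have "u i = u' i" if "i \<in> {b - k..b + k}" for i
      by (rule determined_right[of u u' a b]) (use u assms that in \<open>auto simp: block_eq_iff\<close>)
    then show "?\<beta> u = ?\<beta> u'" by (simp add: block_eq_iff)
  next
    show "?\<beta> x = ?\<beta> v" using l vz assms(3) by (auto simp: block_eq_iff)
    show "?\<alpha> ` {v\<in>X. \<phi> v = \<phi> x} = S" "?\<beta> ` {v\<in>X. \<phi> v = \<phi> x} = S"
      using labels_at[OF \<phi>_in[OF assms(1)]] assms(4,5) by blast+
  qed (use assms(1) v(1,2) fin in simp_all)
  then have xz: "x i = z i" if "i \<in> {a - k..a + k}" for i
    using that v(3) by (auto simp: block_eq_iff)
  show ?thesis by (rule determined_right[OF assms(1-5) y xz i])
qed

lemmas glue = transitive_shift_glue[OF shift_X transitive_X]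

lemma left_transitive_image:
  assumes "left_transitive X x"
  shows "left_transitive Y (\<phi> x)"
proof -
  have x: "x \<in> X" using assms by (simp add: left_transitive_def)
  have "\<exists>s. b + s \<le> N \<and> (\<forall>i\<in>{a..b}. \<phi> x (i + s) = y i)" if y: "y \<in> Y" for y a b N
  proof -
    obtain v where v: "v \<in> X" "y = \<phi> v" using y onto by blast
    obtain s where s: "b + R + s \<le> N" "\<And>i. i \<in> {a - R..b + R} \<Longrightarrow> x (i + s) = v i"
      using left_transitive_obtain[OF shift_X assms v(1)] by blast
    have "\<phi> x (i + s) = y i" if "i \<in> {a..b}" for i
      unfolding v(2)
    proof (rule local)
      show "\<forall>h\<in>{- R..R}. x (i + s + h) = v (i + h)"
        using s(2)[of "i + h" for h] that by (auto simp: add_ac)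
    qed (use x v in auto)
    with s(1) nonneg show ?thesis by force
  qed
  with \<phi>_in[OF x] show ?thesis unfolding left_transitive_iff[OF shift_Y] by blast
qed

text \<open>A word of \<open>Y\<close>, here the window of \<open>\<phi> u\<close> from \<open>- n\<close> to \<open>p + n\<close>, that forces the window \<open>a..b\<close> of \<open>v\<close> to
appear in every point over it whose label lies in \<open>T\<close>. It is lengthened once for each label \<open>Q\<close>:
a point over the word with label \<open>Q\<close> is continued to contain the window of \<open>v\<close> and then
to reach another mark. By determinacy the word so obtained forces the window for \<open>Q\<close>, and it
still does so for the earlier labels as it begins with the old word.\<close>
lemma forcing_word:
  assumes "finite T" "T \<subseteq> S" "v \<in> X" "a \<le> b"
  shows "\<exists>u\<in>X. \<exists>p\<ge>0. marked (\<phi> u) 0 \<and> marked (\<phi> u) p \<and>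
    (\<forall>x\<in>X. (\<forall>i\<in>{- n..p + n}. \<phi> x i = \<phi> u i) \<and> block x (- k) k \<in> T \<longrightarrow>
       (\<exists>s. b + s \<le> p + k \<and> (\<forall>i\<in>{a..b}. x (i + s) = v i)))"
  using assms(1,2)
proof (induction T rule: finite_induct)
  case empty
  obtain x where "x \<in> X" "marked (\<phi> x) 0" by (rule marked_point)
  then show ?case by force
next
  case (insert Q T)
  then obtain u p where u: "u \<in> X" "p \<ge> 0" "marked (\<phi> u) 0" "marked (\<phi> u) p"
    and forced: "\<And>x. \<lbrakk>x \<in> X; \<forall>i\<in>{- n..p + n}. \<phi> x i = \<phi> u i; block x (- k) k \<in> T\<rbrakk> \<Longrightarrow>
       \<exists>s. b + s \<le> p + k \<and> (\<forall>i\<in>{a..b}. x (i + s) = v i)"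
    by auto
  obtain t where t: "t \<in> X" "\<phi> t = \<phi> u" "block t (- k) k = Q"
    using labels_at[OF \<phi>_in[OF u(1)] u(3)] insert.prems by auto
  obtain x0 where x0: "x0 \<in> X" "marked (\<phi> x0) 0" by (rule marked_point)
  \<comment> \<open>Agreement of points up to distance \<open>K\<close> beyond the marks covers the label (radius \<open>k\<close>) and
      the window of \<open>w\<close> in the image (radius \<open>n + R\<close>).\<close>
  define K where "K = n + k + R"
  have K: "n + R \<le> K" "k \<le> K" "0 \<le> K" using nonneg by (auto simp: K_def)
  obtain z1 s where z1: "z1 \<in> X" "\<And>i. i \<in> {- K..p + K} \<Longrightarrow> z1 i = t i"
      "\<And>i. i \<in> {a..b} \<Longrightarrow> z1 (i + s) = v i" "p + K < a + s"
    using glue[OF t(1) assms(3), of "- K" "p + K" a b] u(2) K assms(4) by auto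
  obtain z q where z: "z \<in> X" "\<And>i. i \<in> {- K..b + s} \<Longrightarrow> z i = z1 i"
      "\<And>i. i \<in> {- K..K} \<Longrightarrow> z (i + q) = x0 i" "b + s < - K + q"
    using glue[OF z1(1) x0(1), of "- K" "b + s" "- K" K] z1(4) u(2) K assms(4) by auto
  have pq: "p \<le> q" using z(4) z1(4) K assms(4) by linarith
  have zt: "z i = t i" if "i \<in> {- K..p + K}" for i
    using that z1(2,4) z(2) assms(4) by auto
  have \<phi>zu: "\<phi> z i = \<phi> u i" if "i \<in> {- n..p + n}" for i
    unfolding t(2)[symmetric] using that K by (intro \<phi>_eq z t zt) auto
  have m0: "marked (\<phi> z) 0" using \<phi>zu u(2) by (intro marked_cong[OF u(3)]) auto
  have mq: "marked (\<phi> z) q"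
  proof (rule marked_cong[OF x0(2)])
    fix i assume "i \<in> {- n..n}"
    then have "\<forall>h\<in>{- R..R}. z (i + q + h) = x0 (i + 0 + h)"
      using z(3)[of "i + h" for h] K by (auto simp: add_ac)
    then show "\<phi> z (i + q) = \<phi> x0 (i + 0)" using z x0 by (intro local) auto
  qed
  have "\<exists>s. b + s \<le> q + k \<and> (\<forall>i\<in>{a..b}. x (i + s) = v i)"
    if x: "x \<in> X" "\<forall>i\<in>{- n..q + n}. \<phi> x i = \<phi> z i" "block x (- k) k \<in> insert Q T" for x
  proof (cases "block x (- k) k \<in> T")
    case True
    have "\<forall>i\<in>{- n..p + n}. \<phi> x i = \<phi> u i" using x(2) \<phi>zu pq by auto
    from forced[OF x(1) this True] pq show ?thesis by force
  next
    case False
    then have "block x (- k) k = block t (- k) k" using x(3) t(3) by simp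
    then have "z i = x i" if "i \<in> {0 - k..0 + k}" for i
      using zt[of i] that K u(2) by (auto simp: block_eq_iff)
    then have zx: "z i = x i" if "i \<in> {- k..q + k}" for i
      using determined_right[OF z(1) x(1) _ m0 mq] x(2) u(2) pq that by simp
    have "x (i + s) = v i" if i: "i \<in> {a..b}" for i
    proof -
      have r: "i + s \<in> {- k..q + k}" "i + s \<in> {- K..b + s}"
        using i z1(4) z(4) K u(2) nonneg unfolding atLeastAtMost_iff by linarith+
      have "x (i + s) = z (i + s)" using zx[OF r(1)] by simp
      also have "\<dots> = z1 (i + s)" using z(2)[OF r(2)] .
      also have "\<dots> = v i" using z1(3)[OF i] .
      finally show ?thesis .
    qed
    moreover have "b + s \<le> q + k" using z(4) K nonneg by linarith
    ultimately show ?thesis by blast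
  qed
  with z(1) u(2) pq m0 mq show ?case by (intro bexI[of _ z] exI[of _ q]) auto
qed

text \<open>With \<open>T = S\<close> the forcing word leaves no choice of label, and it occurs arbitrarily far to the left.\<close>
lemma left_transitive_lift:
  assumes "x \<in> X" "left_transitive Y (\<phi> x)"
  shows "left_transitive X x"
proof -
  have "\<exists>s. b + s \<le> N \<and> (\<forall>i\<in>{a..b}. x (i + s) = v i)" if v: "v \<in> X" for v a b N
  proof (cases "a \<le> b")
    case True
    obtain u p where u: "u \<in> X" "p \<ge> 0" "marked (\<phi> u) 0"
      and forced: "\<And>x. \<lbrakk>x \<in> X; \<forall>i\<in>{- n..p + n}. \<phi> x i = \<phi> u i; block x (- k) k \<in> S\<rbrakk> \<Longrightarrow>
       \<exists>s. b + s \<le> p + k \<and> (\<forall>i\<in>{a..b}. x (i + s) = v i)"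
      using forcing_word[OF fin order_refl v True] by auto
    obtain t where t: "p + n + t \<le> N - k" "\<And>i. i \<in> {- n..p + n} \<Longrightarrow> \<phi> x (i + t) = \<phi> u i"
      using left_transitive_obtain[OF shift_Y assms(2) \<phi>_in[OF u(1)]] by blast
    let ?x = "translate t x"
    have \<phi>x: "\<forall>i\<in>{- n..p + n}. \<phi> ?x i = \<phi> u i" using t(2) assms(1) by (simp add: \<phi>_translate)
    have X: "?x \<in> X" using assms(1) by (rule translate_X)
    have "marked (\<phi> ?x) 0" using \<phi>x u(2) by (intro marked_cong[OF u(3)]) auto
    then have "block ?x (- k) k \<in> S" using labels_at[OF \<phi>_in[OF X], of 0] X by auto
    from forced[OF X \<phi>x this] obtain s where
      s: "b + s \<le> p + k" "\<forall>i\<in>{a..b}. ?x (i + s) = v i" by blast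
    then show ?thesis using t(1) nonneg by (intro exI[of _ "s + t"]) (auto simp: add_ac)
  next
    case False
    then show ?thesis by (intro exI[of _ "N - b"]) auto
  qed
  with assms(1) show ?thesis unfolding left_transitive_iff[OF shift_X] by blast
qed

lemma marked_on_left:
  assumes "left_transitive Y y"
  obtains j where "j \<le> N" "marked y j"
proof -
  obtain x where x: "x \<in> X" "marked (\<phi> x) 0" by (rule marked_point)
  obtain s where s: "n + s \<le> N" "\<And>i. i \<in> {- n..n} \<Longrightarrow> y (i + s) = \<phi> x i"
    using left_transitive_obtain[OF shift_Y assms \<phi>_in[OF x(1)]] by blast
  have "marked y s" using s(2) by (intro marked_cong[OF x(2)]) auto
  with s(1) nonneg show ?thesis by (intro that[of s]) auto
qed

lemma continue_to_marked:
  assumes "z \<in> X" "a \<le> c"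
  obtains v q where "v \<in> X" "\<And>i. i \<in> {a..c} \<Longrightarrow> v i = z i" "marked (\<phi> v) q" "c + n + R < q"
proof -
  obtain x where x: "x \<in> X" "marked (\<phi> x) 0" by (rule marked_point)
  let ?K = "n + R"
  obtain v q where v: "v \<in> X" "\<And>i. i \<in> {a..c} \<Longrightarrow> v i = z i"
      "\<And>i. i \<in> {- ?K..?K} \<Longrightarrow> v (i + q) = x i" "c < - ?K + q"
    using glue[OF assms(1) x(1), of a c "- ?K" ?K] assms(2) nonneg by auto
  have "marked (\<phi> v) q"
  proof (rule marked_cong[OF x(2)])
    fix i assume "i \<in> {- n..n}"
    then have "\<forall>h\<in>{- R..R}. v (i + q + h) = x (i + 0 + h)"
      using v(3)[of "i + h" for h] by (auto simp: add_ac)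
    then show "\<phi> v (i + q) = \<phi> x (i + 0)" using v x by (intro local) auto
  qed
  with v show ?thesis by (intro that[of v q]) auto
qed

lemma half_synchronized_image:
  assumes "half_synchronized X"
  shows "half_synchronized Y"
proof -
  obtain x0 a0 c where x0: "left_transitive X x0" "synchronizes X x0 a0 c"
    using assms by (auto simp: half_synchronized_iff[OF shift_X])
  \<comment> \<open>The synchronizing window may be empty, but gluing needs a nonempty one.\<close>
  define a where "a = min a0 c"
  have sync: "synchronizes X x0 a c" using synchronizes_mono[OF x0(2)] by (simp add: a_def)
  have "x0 \<in> X" using x0(1) by (simp add: left_transitive_def)
  then obtain v T where v: "v \<in> X" "\<And>i. i \<in> {a..c} \<Longrightarrow> v i = x0 i"
      "marked (\<phi> v) T" "c + n + R < T"
    using continue_to_marked[of x0 a c] by (auto simp: a_def)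
  define x where "x = splice_at c x0 v"
  have X: "x \<in> X" using sync v by (auto simp: synchronizes_def x_def)
  have xl: "x i = x0 i" if "i \<le> c" for i using that by (simp add: x_def splice_at_def)
  have xr: "x i = v i" if "a \<le> i" for i using that v(2)[of i] by (simp add: x_def splice_at_def)
  have lt: "left_transitive X x" using xl by (intro left_transitive_if_same_left_ray[OF shift_X x0(1) X])
  define y where "y = \<phi> x"
  have lty: "left_transitive Y y" unfolding y_def by (rule left_transitive_image[OF lt])
  have mT: "marked y T" unfolding y_def
    using v(4) nonneg by (intro marked_cong[OF v(3)] \<phi>_eq X v xr) (auto simp: a_def)
  obtain q where q: "q \<le> a - R" "marked y q" using marked_on_left[OF lty] by blast
  have ac: "a \<le> c" by (simp add: a_def)
  have "synchronizes Y y (q - n) (T + n)" unfolding synchronizes_def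
  proof (intro ballI impI)
    fix y' assume y': "y' \<in> Y" "\<forall>i\<in>{q - n..T + n}. y' i = y i"
    have "marked y' q"
      using y'(2) q v(4) nonneg ac by (intro marked_cong[OF q(2)]) auto
    obtain x' where x': "x' \<in> X" "\<phi> x' = y'" "\<And>i. i \<in> {q - k..q + k} \<Longrightarrow> x' i = x i"
      using label_lift[OF X y'(1) \<open>marked y' q\<close> q(2)[unfolded y_def]] by blast
    have x'x: "x' i = x i" if "i \<in> {q - k..T + k}" for i
      using determined_right[of x x' q T i] X x' q mT y'(2) v(4) nonneg that ac
      by (auto simp: y_def)
    \<comment> \<open>The image of \<open>u\<close> is the required splice: \<open>u\<close> agrees with \<open>x\<close> far beyond \<open>c\<close> and with \<open>x'\<close> far
        before \<open>c\<close>, so the block map never sees the seam.\<close>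
    define u where "u = splice_at c x0 x'"
    have u: "u \<in> X" unfolding u_def
    proof (rule sync[unfolded synchronizes_def, rule_format])
      show "x' i = x0 i" if "i \<in> {a..c}" for i
        using that q v(4) nonneg xl x'x by auto
    qed (use x' in simp)
    have ux: "u i = x i" if "i \<le> T + k" for i
      using that x'x[of i] q nonneg ac by (cases "i \<le> c") (auto simp: u_def splice_at_def xl)
    have ux': "u i = x' i" if "q - k \<le> i" for i
      using that x'x[of i] v(4) nonneg by (cases "i \<le> c") (auto simp: u_def splice_at_def xl)
    have "\<phi> u i = splice_at (T + n) y y' i" for i
    proof (cases "i \<le> c")
      case True
      then have "\<phi> u i = \<phi> x i" using v(4) nonneg by (intro \<phi>_eq u X ux) auto
      with True v(4) nonneg show ?thesis by (simp add: splice_at_def y_def)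
    next
      case False
      then have "\<phi> u i = \<phi> x' i" using q nonneg ac by (intro \<phi>_eq u x' ux') auto
      with False x' y'(2) q ac nonneg show ?thesis by (auto simp: splice_at_def)
    qed
    then show "splice_at (T + n) y y' \<in> Y" using \<phi>_in[OF u] ext[of "\<phi> u"] by metis
  qed
  with lty show ?thesis unfolding half_synchronized_iff[OF shift_Y] by blast
qed

lemma half_synchronized_lift:
  assumes "half_synchronized Y"
  shows "half_synchronized X"
proof -
  obtain y a c where y: "left_transitive Y y" "synchronizes Y y a c"
    using assms by (auto simp: half_synchronized_iff[OF shift_Y])
  then have "y \<in> Y" by (simp add: left_transitive_def)
  then obtain x where x: "x \<in> X" "\<phi> x = y" using onto by blast
  have lt: "left_transitive X x" using left_transitive_lift x y(1) by blast
  obtain q where q: "q \<le> c - n" "marked y q" using marked_on_left[OF y(1)] by blast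
  \<comment> \<open>The window is widened by \<open>R\<close> so that points agreeing with \<open>x\<close> on it have images agreeing
      with \<open>y\<close> on \<open>a..c\<close> and on the mark \<open>q\<close>, and it contains the label at \<open>q\<close>.\<close>
  define a' c' where "a' = min a (min (q - n) (q - k)) - R" and "c' = max c (q + k) + R"
  have a': "a' + R \<le> a" "a' + R \<le> q - n" "a' + R \<le> q - k"
    and c': "c + R \<le> c'" "q + k + R \<le> c'" by (auto simp: a'_def c'_def)
  have "synchronizes X x a' c'" unfolding synchronizes_def
  proof (intro ballI impI)
    fix z assume z: "z \<in> X" "\<forall>i\<in>{a'..c'}. z i = x i"
    show "splice_at c' x z \<in> X"
    proof (rule subshift_limit[OF subshift_X])
      fix M
      obtain v T where v: "v \<in> X" "\<And>i. i \<in> {a'..max M c'} \<Longrightarrow> v i = z i"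
          "marked (\<phi> v) T" "max M c' + n + R < T"
      proof (rule continue_to_marked[OF z(1)])
        show "a' \<le> max M c'" using a' c' q nonneg by linarith
      qed blast
      have vx: "v i = x i" if "i \<in> {a'..c'}" for i using v(2) z(2) that by auto
      have \<phi>v: "\<phi> v i = y i" if "i \<in> {a' + R..c' - R}" for i
        unfolding x(2)[symmetric] using that by (intro \<phi>_eq v x vx) auto
      define y' where "y' = splice_at c y (\<phi> v)"
      have y': "y' \<in> Y" unfolding y'_def
        using \<phi>v a' c' by (intro y(2)[unfolded synchronizes_def, rule_format] \<phi>_in v) auto
      have y'l: "y' i = y i" if "i \<le> c" for i using that by (simp add: y'_def splice_at_def)
      have y'r: "y' i = \<phi> v i" if "i \<ge> q - n" for i
        using that \<phi>v[of i] a' c' by (auto simp: y'_def splice_at_def)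
      have mq: "marked y' q" using q y'l by (intro marked_cong[OF q(2)]) auto
      have mT: "marked y' T"
        using v(4) y'r q c' nonneg by (intro marked_cong[OF v(3)]) auto
      obtain x' where x': "x' \<in> X" "\<phi> x' = y'" "\<And>i. i \<in> {q - k..q + k} \<Longrightarrow> x' i = x i"
        using label_lift[OF x(1) y' mq q(2)[folded x(2)]] by blast
      \<comment> \<open>Between the marks \<open>q\<close> and \<open>T\<close> the lift follows \<open>v\<close>, and to the left of \<open>q\<close> it follows \<open>x\<close>,
          in both cases because it has the label of \<open>x\<close> at \<open>q\<close>.\<close>
      have right: "x' i = v i" if "i \<in> {q - k..T + k}" for i
        by (rule determined_right[of x' v q T i])
          (use v mq mT x' y'r vx a' c' nonneg that in auto)
      have left: "x' i = x i" if i: "i \<le> q + k" for i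
      proof -
        obtain j where j: "j \<le> min i q" "marked y j" using marked_on_left[OF y(1)] by blast
        have mj: "marked y' j" using j y'l q nonneg by (intro marked_cong[OF j(2)]) auto
        show ?thesis
          by (rule determined_left[of x' x j q i])
            (use x x' j mj mq y'l q nonneg i in auto)
      qed
      have "x' i = splice_at c' x z i" if "i \<in> {- M..M}" for i
      proof (cases "i \<le> q + k")
        case True
        then show ?thesis using left c' nonneg by (auto simp: splice_at_def)
      next
        case False
        then have "x' i = v i" "v i = z i"
          using that v(4) a' c' nonneg by (auto intro!: right v(2))
        moreover have "z i = x i" if "i \<le> c'" using False that z(2) a' nonneg by auto
        ultimately show ?thesis by (auto simp: splice_at_def)
      qed
      with x'(1) show "\<exists>u\<in>X. \<forall>i\<in>{- M..M}. u i = splice_at c' x z i" by blast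
    qed
  qed
  with lt show ?thesis unfolding half_synchronized_iff[OF shift_X] by blast
qed

end

theorem theorem3p3:
  fixes A :: "'a set" and D :: "'b set"
    and X :: "(int \<Rightarrow> 'a) set" and Y :: "(int \<Rightarrow> 'b) set"
    and \<phi> :: "(int \<Rightarrow> 'a) \<Rightarrow> (int \<Rightarrow> 'b)"
  assumes "subshift A X" and "transitive_shift X"
    and "subshift D Y" and "transitive_shift Y"
    and "factor_map X Y \<phi>" and "hyperbolic X Y \<phi>"
  shows "half_synchronized X \<longleftrightarrow> half_synchronized Y"
proof -
  have shifts: "shift ` X = X" "shift ` Y = Y" using assms by (auto simp: subshift_def)
  obtain mm nn :: int and \<Phi> where \<Phi>: "\<phi> ` X = Y" "- mm \<le> nn"
      "\<forall>x\<in>X. \<forall>i. \<phi> x i = \<Phi> (block x (i - mm) (i + nn))"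
    using assms(5) unfolding factor_map_def by blast
  \<comment> \<open>Either of the two bounds of the coding window may be negative.\<close>
  define R where "R = max \<bar>mm\<bar> \<bar>nn\<bar>"
  have loc: "\<phi> x i = \<phi> z j" if "x \<in> X" "z \<in> X" "\<forall>h\<in>{- R..R}. x (i + h) = z (j + h)" for x z i j
  proof -
    have "x (h + i) = z (h + j)" if "h \<in> {- mm..nn}" for h
    proof -
      have "h \<in> {- R..R}" using that by (auto simp: R_def)
      with \<open>\<forall>h\<in>{- R..R}. x (i + h) = z (j + h)\<close> have "x (i + h) = z (j + h)" by blast
      then show ?thesis by (simp only: add.commute)
    qed
    then have "block (translate i x) (- mm) nn = block (translate j z) (- mm) nn"
      by (simp add: block_eq_iff)
    then show ?thesis using \<Phi>(3) that(1,2) by (simp add: block_translate algebra_simps)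
  qed
  from assms(6) obtain d n k w m where
      w: "w \<in> blocks Y (2 * n + 1)"
    and labels: "\<forall>y\<in>Y. block y (- int n) (int n) = w \<longrightarrow>
           {block x (- int k) (int k) | x. x \<in> X \<and> \<phi> x = y} = m ` {1..d::nat}"
    and det: "\<forall>w'\<in>language Y. \<forall>p.
           length w' = 2 * n + 1 + p \<and> take (2 * n + 1) w' = w \<and> drop p w' = w \<longrightarrow>
           (\<forall>i\<in>{1..d}. \<exists>!a. a \<in> language X \<and>
              (\<forall>x\<in>X. block (\<phi> x) (- int n) (int n + int p) = w' \<and>
                 block x (- int k) (int k) = m i \<longrightarrow>
                 block x (- int k) (int k + int p) = a))"
    unfolding hyperbolic_def by (elim exE conjE) (rule that; assumption)
  interpret hyperbolic_code A X Y \<phi> R "int n" "int k" w "m ` {1..d}"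
  proof
    show "\<exists>y\<in>Y. block y (- int n) (int n) = w"
    proof -
      have "w \<in> language Y" using w unfolding language_def by blast
      then obtain y where "y \<in> Y" "block y (- int n) (- int n + int (length w) - 1) = w"
        using language_cases[OF shifts(2)] by blast
      moreover have "length w = 2 * n + 1" using w by (auto simp: blocks_def length_block)
      ultimately show ?thesis by auto
    qed
    show "(\<lambda>x. block x (- int k) (int k)) ` {x\<in>X. \<phi> x = y} = m ` {1..d}"
      if "y \<in> Y" "block y (- int n) (int n) = w" for y
      unfolding labels[rule_format, OF that, symmetric] by blast
    fix x z and p :: int
    assume x: "x \<in> X" "z \<in> X" "0 \<le> p" "block (\<phi> x) (- int n) (int n) = w"
        "block (\<phi> x) (p - int n) (p + int n) = w"
        "block (\<phi> x) (- int n) (p + int n) = block (\<phi> z) (- int n) (p + int n)"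
        "block x (- int k) (int k) = block z (- int k) (int k)"
    define w' where "w' = block (\<phi> x) (- int n) (int n + p)"
    have "w' \<in> language Y" unfolding w'_def using x(1) \<Phi>(1) by (intro block_in_language) auto
    moreover have "length w' = 2 * n + 1 + nat p" using x(3) by (simp add: w'_def length_block)
    moreover have "take (2 * n + 1) w' = w" unfolding x(4)[symmetric] w'_def
      using x(3) by (intro nth_equalityI) (auto simp: length_block nth_block)
    moreover have "drop (nat p) w' = w" unfolding x(5)[symmetric] w'_def
      using x(3) by (intro nth_equalityI) (auto simp: length_block nth_block algebra_simps)
    moreover obtain i where i: "i \<in> {1..d}" "block x (- int k) (int k) = m i"
      using labels[rule_format, of "\<phi> x"] x(1,4) \<Phi>(1) by blast
    ultimately have "\<exists>!b. b \<in> language X \<and>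
        (\<forall>v\<in>X. block (\<phi> v) (- int n) (int n + int (nat p)) = w' \<and>
           block v (- int k) (int k) = m i \<longrightarrow>
           block v (- int k) (int k + int (nat p)) = b)"
      by (intro det[rule_format]) simp_all
    then obtain b where b: "\<And>v. v \<in> X \<Longrightarrow> block (\<phi> v) (- int n) (int n + int (nat p)) = w' \<Longrightarrow>
        block v (- int k) (int k) = m i \<Longrightarrow> block v (- int k) (int k + int (nat p)) = b"
      by blast
    have "block x (- int k) (int k + p) = b"
      using b[OF x(1)] x(3) i(2) by (simp add: w'_def)
    moreover have "block z (- int k) (int k + p) = b"
      using b[OF x(2)] x(3,6,7) i(2) by (simp add: w'_def add.commute)
    ultimately show "block x (- int k) (p + int k) = block z (- int k) (p + int k)"
      by (simp add: add.commute)
  qed (use assms shifts \<Phi> loc in \<open>auto simp: R_def\<close>)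
  show ?thesis using half_synchronized_image half_synchronized_lift by blast
qed

end
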